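(* Let $n\ge 1$ and let $i,j$ be integers with $0\le i\le j\le n$ and $i+j>n$. If $f\in U_{[i,j]}(n,2)$ and $f\not\equiv 0$, then $$|f|\ge 2^{i}.$$ Moreover, this bound is sharp: for all such $n,i,j$ there exists $f\in U_{[i,j]}(n,2)$, $f\not\equiv 0$, with $|f|=2^{i}$.
   Context: For $q\ge 2$ let $\Sigma_q=\{0,1,\ldots,q-1\}$. The Hamming graph $H(n,q)$ has vertex set $\Sigma_q^n$, and two vertices are adjacent if they differ in exactly one coordinate. The eigenvalues of its adjacency matrix are $\lambda_i(n,q)=n(q-1)-q\cdot i$ for $0\le i\le n$. Let $U_i(n,q)$ be the $\lambda_i(n,q)$-eigenspace, i.e. the space of functions $f:\Sigma_q^n\to\mathbb{R}$ with $\lambda_i(n,q)f(x)=\sum_{y\in N(x)}f(y)$ for every vertex $x$, where $N(x)$ is the set of neighbors of $x$. For $0\le i\le j\le n$ let $U_{[i,j]}(n,q)=U_i(n,q)\oplus U_{i+1}(n,q)\oplus\cdots\oplus U_j(n,q)$. For a function $f:\Sigma_q^n\to\mathbb{R}$, $|f|$ denotes the cardinality of its support $\{x : f(x)\ne 0\}$. *)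

theory Defs
  imports Complex_Main
begin

definition hamming_vertices :: "nat \<Rightarrow> nat \<Rightarrow> nat list set" where
  "hamming_vertices n q = {x. set x \<subseteq> {..<q} \<and> length x = n}"

definition hamming_adj :: "nat \<Rightarrow> nat list \<Rightarrow> nat list \<Rightarrow> bool" where
  "hamming_adj n x y \<longleftrightarrow> card {k. k < n \<and> x ! k \<noteq> y ! k} = 1"

definition hamming_nbrs :: "nat \<Rightarrow> nat \<Rightarrow> nat list \<Rightarrow> nat list set" where
  "hamming_nbrs n q x = {y \<in> hamming_vertices n q. hamming_adj n x y}"

definition hamming_eigenvalue :: "nat \<Rightarrow> nat \<Rightarrow> nat \<Rightarrow> real" where
  "hamming_eigenvalue n q i = real n * (real q - 1) - real q * real i"

(* A real function on the vertex set is represented by the function on all lists that extends it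
   by 0, so that equality of functions is equality on the vertex set. *)
definition vertex_functions :: "nat \<Rightarrow> nat \<Rightarrow> (nat list \<Rightarrow> real) set" where
  "vertex_functions n q = {f. \<forall>x. x \<notin> hamming_vertices n q \<longrightarrow> f x = 0}"

definition eigenspace :: "nat \<Rightarrow> nat \<Rightarrow> nat \<Rightarrow> (nat list \<Rightarrow> real) set" where
  "eigenspace n q i =
     {f \<in> vertex_functions n q. \<forall>x \<in> hamming_vertices n q.
        hamming_eigenvalue n q i * f x = (\<Sum>y \<in> hamming_nbrs n q x. f y)}"

(* The sum of the eigenspaces with indices i, ..., j. It is direct for q > 0, since the
   eigenvalues are then pairwise distinct. *)
definition eigenspace_sum :: "nat \<Rightarrow> nat \<Rightarrow> nat \<Rightarrow> nat \<Rightarrow> (nat list \<Rightarrow> real) set" where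
  "eigenspace_sum n q i j =
     {f. \<exists>g. (\<forall>k \<in> {i..j}. g k \<in> eigenspace n q k) \<and> f = (\<lambda>x. \<Sum>k = i..j. g k x)}"

definition support_size :: "nat \<Rightarrow> nat \<Rightarrow> (nat list \<Rightarrow> real) \<Rightarrow> nat" where
  "support_size n q f = card {x \<in> hamming_vertices n q. f x \<noteq> 0}"

end

theory Submission
  imports Defs
begin

text \<open>
  Everything rests on splitting the cube along its first coordinate. A function \<open>f\<close> on
  \<open>{0,1}^(n+1)\<close> has two slices \<open>f\<^sub>0\<close> and \<open>f\<^sub>1\<close> on \<open>{0,1}^n\<close>, and the adjacency operator
  acts on each slice as the smaller adjacency operator plus a swap of the two slices. The swap is
  diagonalised by sum and difference: if \<open>f \<in> U\<^sub>k(n+1,2)\<close> then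
  \<open>f\<^sub>0 + f\<^sub>1 \<in> U\<^sub>k(n,2)\<close> and \<open>f\<^sub>0 - f\<^sub>1 \<in> U\<^bsub>k-1\<^esub>(n,2)\<close> for \<open>k \<ge> 1\<close>; conversely, tensoring with the
  constant function, or with the sign character, of one extra coordinate maps \<open>U\<^sub>k(n,2)\<close> into
  \<open>U\<^sub>k(n+1,2)\<close>, or into \<open>U\<^bsub>k+1\<^esub>(n+1,2)\<close>.

  Lower bound (\<open>support_size_ge\<close>): by induction on \<open>n\<close>. If \<open>f\<^sub>0 + f\<^sub>1\<close> is nonzero, then its
  support already has at least \<open>2^i\<close> points, and it is covered by the supports of the two slices.
  Otherwise \<open>f\<^sub>1 = - f\<^sub>0\<close>, both slices have the same support, and
  \<open>2 f\<^sub>0 = f\<^sub>0 - f\<^sub>1\<close> has spectral indices at least \<open>i - 1\<close>, so the support of \<open>f\<close> has at least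
  \<open>2 * 2^(i-1)\<close> points.

  Sharpness (\<open>support_size_attained\<close>): the extremal function is a tensor product of \<open>n - j\<close>
  copies of the function \<open>\<delta>\<^bsub>01\<^esub> - \<delta>\<^bsub>10\<^esub>\<close> in \<open>U\<^sub>1(2,2)\<close>, \<open>i + j - n\<close> copies of the sign
  character in \<open>U\<^sub>1(1,2)\<close>, and \<open>j - i\<close> copies of the point mass \<open>\<delta>\<^sub>0\<close> in
  \<open>U\<^bsub>[0,1]\<^esub>(1,2)\<close>. The supports of these factors have 2, 2 and 1 points, and the
  spectral indices add up to the interval \<open>[i,j]\<close>.
\<close>

section \<open>The binary Hamming graph along its first coordinate\<close>

lemma finite_hamming_vertices: "finite (hamming_vertices n q)"
  unfolding hamming_vertices_def by (rule finite_lists_length_eq) simp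

lemma Cons_in_hamming_vertices:
  "a # x \<in> hamming_vertices (Suc n) q \<longleftrightarrow> a < q \<and> x \<in> hamming_vertices n q"
  by (auto simp: hamming_vertices_def)

lemma hamming_vertices_0: "hamming_vertices 0 q = {[]}"
  by (auto simp: hamming_vertices_def)

lemma hamming_vertices_SucE:
  assumes "z \<in> hamming_vertices (Suc n) q"
  obtains a x where "z = a # x" "a < q" "x \<in> hamming_vertices n q"
  using assms by (cases z) (auto simp: hamming_vertices_def)

lemma card_mismatches_Cons:
  "card {k. k < Suc n \<and> (a # x) ! k \<noteq> (b # y) ! k}
     = of_bool (a \<noteq> b) + card {k. k < n \<and> x ! k \<noteq> y ! k}"
proof -
  have "{k. k < Suc n \<and> (a # x) ! k \<noteq> (b # y) ! k}
          = (if a = b then {} else {0}) \<union> Suc ` {k. k < n \<and> x ! k \<noteq> y ! k}"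
    by (auto simp: image_iff less_Suc_eq_0_disj)
  then show ?thesis
    by (simp add: card_image)
qed

lemma no_mismatch_iff_eq:
  assumes "x \<in> hamming_vertices n q" "y \<in> hamming_vertices n q"
  shows "card {k. k < n \<and> x ! k \<noteq> y ! k} = 0 \<longleftrightarrow> x = y"
  using assms by (auto simp: hamming_vertices_def list_eq_iff_nth_eq)

lemma hamming_nbrs_Cons:
  assumes "a < 2" "x \<in> hamming_vertices n 2"
  shows "hamming_nbrs (Suc n) 2 (a # x) = insert ((1 - a) # x) (Cons a ` hamming_nbrs n 2 x)"
proof (intro set_eqI iffI)
  fix z assume z: "z \<in> hamming_nbrs (Suc n) 2 (a # x)"
  then obtain b y where zb: "z = b # y" "b < 2" "y \<in> hamming_vertices n 2"
    by (auto simp: hamming_nbrs_def elim: hamming_vertices_SucE)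
  have "hamming_adj (Suc n) (a # x) (b # y)"
    using z by (simp add: zb(1) hamming_nbrs_def)
  then have one: "of_bool (a \<noteq> b) + card {k. k < n \<and> x ! k \<noteq> y ! k} = 1"
    unfolding hamming_adj_def card_mismatches_Cons .
  show "z \<in> insert ((1 - a) # x) (Cons a ` hamming_nbrs n 2 x)"
  proof (cases "a = b")
    case True
    with one zb show ?thesis by (simp add: hamming_nbrs_def hamming_adj_def)
  next
    case False
    with one have "x = y" using no_mismatch_iff_eq[OF assms(2) zb(3)] by simp
    moreover have "b = 1 - a" using False assms(1) zb(2) by linarith
    ultimately show ?thesis using zb(1) by simp
  qed
next
  fix z assume "z \<in> insert ((1 - a) # x) (Cons a ` hamming_nbrs n 2 x)"
  then consider "z = (1 - a) # x" | y where "z = a # y" "y \<in> hamming_nbrs n 2 x"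
    by blast
  then show "z \<in> hamming_nbrs (Suc n) 2 (a # x)"
  proof cases
    case 1
    moreover have "a \<noteq> 1 - a" by presburger
    ultimately show ?thesis using assms
      by (simp add: hamming_nbrs_def hamming_adj_def Cons_in_hamming_vertices
            card_mismatches_Cons del: nth_Cons_Suc)
  next
    case 2
    then show ?thesis using assms
      by (simp add: hamming_nbrs_def hamming_adj_def Cons_in_hamming_vertices
            card_mismatches_Cons)
  qed
qed

text \<open>The adjacency operator in block form: the smaller adjacency operator on each slice, plus the
  swap of the slices.\<close>

lemma sum_hamming_nbrs_Cons:
  fixes f :: "nat list \<Rightarrow> real"
  assumes "a < 2" "x \<in> hamming_vertices n 2"
  shows "(\<Sum>z \<in> hamming_nbrs (Suc n) 2 (a # x). f z)
           = f ((1 - a) # x) + (\<Sum>y \<in> hamming_nbrs n 2 x. f (a # y))"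
proof -
  have "finite (hamming_nbrs n 2 x)"
    by (simp add: hamming_nbrs_def finite_hamming_vertices)
  moreover have "1 - a \<noteq> a"
    by presburger
  then have "(1 - a) # x \<notin> Cons a ` hamming_nbrs n 2 x"
    using \<open>1 - a \<noteq> a\<close> by auto
  ultimately show ?thesis
    by (simp add: hamming_nbrs_Cons[OF assms] sum.reindex)
qed

lemma hamming_eigenvalue_Suc:
  "hamming_eigenvalue (Suc n) 2 k = hamming_eigenvalue n 2 k + 1"
  "hamming_eigenvalue (Suc n) 2 (Suc k) = hamming_eigenvalue n 2 k - 1"
  by (simp_all add: hamming_eigenvalue_def)

lemma support_size_Suc:
  "support_size (Suc n) 2 f
     = support_size n 2 (\<lambda>x. f (0 # x)) + support_size n 2 (\<lambda>x. f (1 # x))"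
proof -
  let ?S = "\<lambda>a. {x \<in> hamming_vertices n 2. f (a # x) \<noteq> 0}"
  have "{z \<in> hamming_vertices (Suc n) 2. f z \<noteq> 0} = Cons 0 ` ?S 0 \<union> Cons 1 ` ?S 1"
  proof (intro set_eqI iffI)
    fix z assume "z \<in> {z \<in> hamming_vertices (Suc n) 2. f z \<noteq> 0}"
    then show "z \<in> Cons 0 ` ?S 0 \<union> Cons 1 ` ?S 1"
      by (auto elim!: hamming_vertices_SucE simp: less_2_cases_iff)
  qed (auto simp: Cons_in_hamming_vertices)
  moreover have "card (Cons 0 ` ?S 0 \<union> Cons 1 ` ?S 1) = card (?S 0) + card (?S 1)"
    by (subst card_Un_disjoint) (auto simp: finite_hamming_vertices card_image)
  ultimately show ?thesis
    by (simp add: support_size_def)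
qed

section \<open>Linear structure of the spectral intervals\<close>

lemma eigenspace_lincomb:
  assumes "f \<in> eigenspace n q k" "g \<in> eigenspace n q k"
  shows "(\<lambda>x. a * f x + b * g x) \<in> eigenspace n q k"
proof -
  have "hamming_eigenvalue n q k * (a * f x + b * g x)
          = (\<Sum>y \<in> hamming_nbrs n q x. a * f y + b * g y)"
    if "x \<in> hamming_vertices n q" for x
  proof -
    have "hamming_eigenvalue n q k * (a * f x + b * g x)
            = a * (hamming_eigenvalue n q k * f x) + b * (hamming_eigenvalue n q k * g x)"
      by (simp add: algebra_simps)
    then show ?thesis
      using assms that by (simp add: eigenspace_def sum.distrib sum_distrib_left)
  qed
  with assms show ?thesis
    by (simp add: eigenspace_def vertex_functions_def)
qed

lemma zero_in_eigenspace: "(\<lambda>x. 0) \<in> eigenspace n q k"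
  by (simp add: eigenspace_def vertex_functions_def)

lemma eigenspace_sum_lincomb:
  assumes "f \<in> eigenspace_sum n q i j" "g \<in> eigenspace_sum n q i j"
  shows "(\<lambda>x. a * f x + b * g x) \<in> eigenspace_sum n q i j"
proof -
  from assms obtain u v
    where u: "\<forall>k \<in> {i..j}. u k \<in> eigenspace n q k" "f = (\<lambda>x. \<Sum>k = i..j. u k x)"
      and v: "\<forall>k \<in> {i..j}. v k \<in> eigenspace n q k" "g = (\<lambda>x. \<Sum>k = i..j. v k x)"
    by (auto simp: eigenspace_sum_def)
  show ?thesis
    unfolding eigenspace_sum_def
    using u v
    by (intro CollectI exI[of _ "\<lambda>k x. a * u k x + b * v k x"])
      (auto intro: eigenspace_lincomb simp: sum.distrib sum_distrib_left)
qed

lemma eigenspace_sum_mono: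
  assumes "i' \<le> i" "j \<le> j'"
  shows "eigenspace_sum n q i j \<subseteq> eigenspace_sum n q i' j'"
proof
  fix f assume "f \<in> eigenspace_sum n q i j"
  then obtain u where u: "\<forall>k \<in> {i..j}. u k \<in> eigenspace n q k" "f = (\<lambda>x. \<Sum>k = i..j. u k x)"
    by (auto simp: eigenspace_sum_def)
  define v where "v = (\<lambda>k x. if k \<in> {i..j} then u k x else 0)"
  have "v k \<in> eigenspace n q k" for k
    using u(1) by (cases "k \<in> {i..j}") (auto simp: v_def zero_in_eigenspace)
  moreover have "f = (\<lambda>x. \<Sum>k = i'..j'. v k x)"
    unfolding u(2) v_def using assms
    by (intro ext sum.mono_neutral_cong_left) auto
  ultimately show "f \<in> eigenspace_sum n q i' j'"
    by (auto simp: eigenspace_sum_def)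
qed

lemma eigenspace_sum_vertex_function:
  assumes "f \<in> eigenspace_sum n q i j" "x \<notin> hamming_vertices n q"
  shows "f x = 0"
  using assms by (auto simp: eigenspace_sum_def eigenspace_def vertex_functions_def
      intro!: sum.neutral)

lemma support_nonempty:
  assumes "f \<in> eigenspace_sum n q i j" "f \<noteq> (\<lambda>x. 0)"
  shows "support_size n q f \<ge> 1"
proof -
  from assms obtain x where "x \<in> hamming_vertices n q" "f x \<noteq> 0"
    using eigenspace_sum_vertex_function by blast
  then show ?thesis
    by (auto simp: support_size_def finite_hamming_vertices Suc_le_eq card_gt_0_iff)
qed

section \<open>The lower bound\<close>

lemma slice_sum_eigenspace:
  assumes "f \<in> eigenspace (Suc n) 2 k"
  shows "(\<lambda>x. f (0 # x) + f (1 # x)) \<in> eigenspace n 2 k"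
proof -
  have "hamming_eigenvalue n 2 k * (f (0 # x) + f (1 # x))
          = (\<Sum>y \<in> hamming_nbrs n 2 x. f (0 # y) + f (1 # y))"
    if x: "x \<in> hamming_vertices n 2" for x
  proof -
    have "hamming_eigenvalue (Suc n) 2 k * f (a # x)
            = f ((1 - a) # x) + (\<Sum>y \<in> hamming_nbrs n 2 x. f (a # y))" if "a < 2" for a
      using assms x that sum_hamming_nbrs_Cons[OF that x, of f]
      by (simp add: eigenspace_def Cons_in_hamming_vertices)
    from this[of 0] this[of 1] show ?thesis
      by (simp add: hamming_eigenvalue_Suc(1) sum.distrib algebra_simps)
  qed
  with assms show ?thesis
    by (simp add: eigenspace_def vertex_functions_def Cons_in_hamming_vertices)
qed

lemma slice_diff_eigenspace:
  assumes "f \<in> eigenspace (Suc n) 2 (Suc k)"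
  shows "(\<lambda>x. f (0 # x) - f (1 # x)) \<in> eigenspace n 2 k"
proof -
  have "hamming_eigenvalue n 2 k * (f (0 # x) - f (1 # x))
          = (\<Sum>y \<in> hamming_nbrs n 2 x. f (0 # y) - f (1 # y))"
    if x: "x \<in> hamming_vertices n 2" for x
  proof -
    have "hamming_eigenvalue (Suc n) 2 (Suc k) * f (a # x)
            = f ((1 - a) # x) + (\<Sum>y \<in> hamming_nbrs n 2 x. f (a # y))" if "a < 2" for a
      using assms x that sum_hamming_nbrs_Cons[OF that x, of f]
      by (simp add: eigenspace_def Cons_in_hamming_vertices)
    from this[of 0] this[of 1] show ?thesis
      by (simp add: hamming_eigenvalue_Suc(2) sum_subtractf algebra_simps)
  qed
  with assms show ?thesis
    by (simp add: eigenspace_def vertex_functions_def Cons_in_hamming_vertices)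
qed

lemma slice_sum_eigenspace_sum:
  assumes "f \<in> eigenspace_sum (Suc n) 2 i j"
  shows "(\<lambda>x. f (0 # x) + f (1 # x)) \<in> eigenspace_sum n 2 i j"
proof -
  from assms obtain u where "\<forall>k \<in> {i..j}. u k \<in> eigenspace (Suc n) 2 k"
    "f = (\<lambda>x. \<Sum>k = i..j. u k x)"
    by (auto simp: eigenspace_sum_def)
  then show ?thesis
    unfolding eigenspace_sum_def
    by (intro CollectI exI[of _ "\<lambda>k x. u k (0 # x) + u k (1 # x)"])
      (auto simp: sum.distrib intro!: slice_sum_eigenspace[simplified])
qed

lemma slice_diff_eigenspace_sum:
  assumes "f \<in> eigenspace_sum (Suc n) 2 (Suc i) (Suc j)"
  shows "(\<lambda>x. f (0 # x) - f (1 # x)) \<in> eigenspace_sum n 2 i j"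
proof -
  from assms obtain u where "\<forall>k \<in> {Suc i..Suc j}. u k \<in> eigenspace (Suc n) 2 k"
    "f = (\<lambda>x. \<Sum>k = Suc i..Suc j. u k x)"
    by (auto simp: eigenspace_sum_def)
  then show ?thesis
    unfolding eigenspace_sum_def
    by (intro CollectI exI[of _ "\<lambda>k x. u (Suc k) (0 # x) - u (Suc k) (1 # x)"])
      (auto simp: sum.atLeast_Suc_atMost_Suc_shift sum_subtractf
        simp del: sum.cl_ivl_Suc intro!: slice_diff_eigenspace[simplified])
qed

text \<open>The induction goes by slicing: the sum of the slices keeps \<open>i\<close>, and when it vanishes, the
  difference lowers \<open>i\<close> by one while the two slices have equal supports. For \<open>n = 0\<close> the adjacency operator is zero, so
  eigenfunctions with \<open>k > 0\<close> vanish.\<close>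

lemma support_size_ge:
  assumes "f \<in> eigenspace_sum n 2 i j" "f \<noteq> (\<lambda>x. 0)"
  shows "support_size n 2 f \<ge> 2 ^ i"
  using assms
proof (induction n arbitrary: f i j)
  case 0
  show ?case
  proof (cases "i = 0")
    case True
    with support_nonempty[OF 0] show ?thesis by simp
  next
    case False
    from 0 obtain u where u: "\<forall>k \<in> {i..j}. u k \<in> eigenspace 0 2 k"
      "f = (\<lambda>x. \<Sum>k = i..j. u k x)"
      by (auto simp: eigenspace_sum_def)
    have "u k x = 0" if "k \<in> {i..j}" for k x
    proof (cases "x = []")
      case True
      have "hamming_nbrs 0 2 [] = {}"
        by (simp add: hamming_nbrs_def hamming_adj_def)
      then have "hamming_eigenvalue 0 2 k * u k [] = 0"
        using u(1) that by (fastforce simp: eigenspace_def hamming_vertices_0)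
      with True False that show ?thesis by (simp add: hamming_eigenvalue_def)
    next
      case False
      with u(1) that show ?thesis
        by (auto simp: eigenspace_def vertex_functions_def hamming_vertices_0)
    qed
    then have "f = (\<lambda>x. 0)" by (simp add: u(2))
    with 0 show ?thesis by simp
  qed
next
  case (Suc n)
  let ?s = "\<lambda>x. f (0 # x) + f (1 # x)" and ?d = "\<lambda>x. f (0 # x) - f (1 # x)"
  show ?case
  proof (cases "?s = (\<lambda>x. 0)")
    case False
    have "2 ^ i \<le> support_size n 2 ?s"
      using Suc.IH[OF slice_sum_eigenspace_sum[OF Suc.prems(1)] False] .
    also have "\<dots> \<le> card ({x \<in> hamming_vertices n 2. f (0 # x) \<noteq> 0}
                        \<union> {x \<in> hamming_vertices n 2. f (1 # x) \<noteq> 0})"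
      unfolding support_size_def by (intro card_mono) (auto simp: finite_hamming_vertices)
    also have "\<dots> \<le> support_size (Suc n) 2 f"
      unfolding support_size_Suc by (simp add: support_size_def card_Un_le)
    finally show ?thesis .
  next
    case True
    then have neg: "f (Suc 0 # x) = - f (0 # x)" for x
      using fun_cong[OF True, of x] by simp
    show ?thesis
    proof (cases i)
      case 0
      with support_nonempty[OF Suc.prems] show ?thesis by simp
    next
      case (Suc i')
      have "j \<noteq> 0"
      proof
        assume "j = 0"
        with \<open>i = Suc i'\<close> have "f = (\<lambda>x. 0)"
          using Suc.prems(1) by (auto simp: eigenspace_sum_def)
        with Suc.prems(2) show False ..
      qed
      then obtain j' where j': "j = Suc j'" using not0_implies_Suc by blast
      have "?d \<noteq> (\<lambda>x. 0)"
      proof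
        assume d: "?d = (\<lambda>x. 0)"
        have "f z = 0" for z
        proof (cases "z \<in> hamming_vertices (Suc n) 2")
          case True
          then obtain a x where "z = a # x" "a < 2" by (auto elim: hamming_vertices_SucE)
          then show ?thesis
            using neg[of x] fun_cong[OF d, of x] by (auto simp: less_2_cases_iff)
        qed (rule eigenspace_sum_vertex_function[OF Suc.prems(1)])
        with Suc.prems(2) show False by blast
      qed
      with Suc.IH[OF slice_diff_eigenspace_sum] have "2 ^ i' \<le> support_size n 2 ?d"
        using Suc.prems(1) Suc j' by blast
      moreover have "support_size (Suc n) 2 f = 2 * support_size n 2 ?d"
        unfolding support_size_Suc by (simp add: neg support_size_def)
      ultimately show ?thesis by (simp add: Suc)
    qed
  qed
qed

section \<open>Functions attaining the bound\<close>

text \<open>The value is 0 unless the first letter is 0 or 1, so that functions on the vertices of the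
  smaller cube, extended by 0, go to functions of the same kind on the larger one.\<close>

definition tensor_fst :: "(nat \<Rightarrow> real) \<Rightarrow> (nat list \<Rightarrow> real) \<Rightarrow> nat list \<Rightarrow> real" where
  "tensor_fst u h z = (case z of [] \<Rightarrow> 0 | a # x \<Rightarrow> if a < 2 then u a * h x else 0)"

lemma tensor_fst_simps [simp]:
  "tensor_fst u h [] = 0"
  "tensor_fst u h (0 # x) = u 0 * h x"
  "tensor_fst u h (Suc 0 # x) = u 1 * h x"
  by (simp_all add: tensor_fst_def)

abbreviation sign_char :: "nat \<Rightarrow> real" where
  "sign_char a \<equiv> (- 1) ^ a"

text \<open>If \<open>u\<close> is an eigenfunction of the swap of \<open>{0,1}\<close> with eigenvalue \<open>e\<close>, then tensoring with
  \<open>u\<close> shifts adjacency eigenvalues by \<open>e\<close>.\<close>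

lemma tensor_fst_eigenspace:
  assumes h: "h \<in> eigenspace n 2 k"
    and u: "\<And>a. a < 2 \<Longrightarrow> u (1 - a) = e * u a"
    and e: "hamming_eigenvalue (Suc n) 2 l = hamming_eigenvalue n 2 k + e"
  shows "tensor_fst u h \<in> eigenspace (Suc n) 2 l"
proof -
  have "tensor_fst u h \<in> vertex_functions (Suc n) 2"
    using h by (auto simp: eigenspace_def vertex_functions_def tensor_fst_def
        Cons_in_hamming_vertices split: list.split)
  moreover have "hamming_eigenvalue (Suc n) 2 l * tensor_fst u h z
                   = (\<Sum>y \<in> hamming_nbrs (Suc n) 2 z. tensor_fst u h y)"
    if "z \<in> hamming_vertices (Suc n) 2" for z
  proof -
    from that obtain a x where z: "z = a # x" and a: "a < 2" and x: "x \<in> hamming_vertices n 2"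
      by (rule hamming_vertices_SucE)
    have "1 - a < 2"
      by linarith
    have "(\<Sum>y \<in> hamming_nbrs (Suc n) 2 z. tensor_fst u h y)
            = e * u a * h x + u a * (\<Sum>y \<in> hamming_nbrs n 2 x. h y)"
      unfolding z sum_hamming_nbrs_Cons[OF a x]
      using a u[OF a] \<open>1 - a < 2\<close> by (simp add: tensor_fst_def sum_distrib_left)
    also have "(\<Sum>y \<in> hamming_nbrs n 2 x. h y) = hamming_eigenvalue n 2 k * h x"
      using h x by (simp add: eigenspace_def)
    finally show ?thesis
      using a by (simp add: z e tensor_fst_def algebra_simps)
  qed
  ultimately show ?thesis
    by (simp add: eigenspace_def)
qed

lemma tensor_fst_sum: "tensor_fst u (\<lambda>x. \<Sum>k \<in> K. g k x) = (\<lambda>z. \<Sum>k \<in> K. tensor_fst u (g k) z)"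
  by (auto simp: tensor_fst_def sum_distrib_left split: list.split)

lemma tensor_const_eigenspace_sum:
  assumes "h \<in> eigenspace_sum n 2 i j"
  shows "tensor_fst (\<lambda>_. 1) h \<in> eigenspace_sum (Suc n) 2 i j"
proof -
  from assms obtain v where "\<forall>k \<in> {i..j}. v k \<in> eigenspace n 2 k"
    "h = (\<lambda>x. \<Sum>k = i..j. v k x)"
    by (auto simp: eigenspace_sum_def)
  then show ?thesis
    unfolding eigenspace_sum_def
    by (intro CollectI exI[of _ "\<lambda>k. tensor_fst (\<lambda>_. 1) (v k)"])
      (auto simp: tensor_fst_sum hamming_eigenvalue_Suc(1) intro!: tensor_fst_eigenspace[where e = 1])
qed

lemma tensor_sign_eigenspace_sum:
  assumes "h \<in> eigenspace_sum n 2 i j"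
  shows "tensor_fst sign_char h \<in> eigenspace_sum (Suc n) 2 (Suc i) (Suc j)"
proof -
  from assms obtain v where v: "\<forall>k \<in> {i..j}. v k \<in> eigenspace n 2 k"
    and h: "h = (\<lambda>x. \<Sum>k = i..j. v k x)"
    by (auto simp: eigenspace_sum_def)
  let ?g = "\<lambda>k. tensor_fst sign_char (v (k - 1))"
  have "?g k \<in> eigenspace (Suc n) 2 k" if "k \<in> {Suc i..Suc j}" for k
  proof (cases k)
    case (Suc l)
    with v that show ?thesis
      by (intro tensor_fst_eigenspace[where k = l and e = "- 1"])
        (auto simp: hamming_eigenvalue_Suc(2) less_2_cases_iff)
  qed (use that in simp)
  moreover have "tensor_fst sign_char h = (\<lambda>z. \<Sum>k = Suc i..Suc j. ?g k z)"
    unfolding h tensor_fst_sum sum.atLeast_Suc_atMost_Suc_shift by simp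
  ultimately show ?thesis
    unfolding eigenspace_sum_def by (intro CollectI exI[of _ ?g] conjI ballI)
qed

text \<open>The point mass at 0 is the mean of the constant function and the sign character.\<close>

lemma tensor_point_eigenspace_sum:
  assumes "h \<in> eigenspace_sum n 2 i j"
  shows "tensor_fst (\<lambda>a. of_bool (a = 0)) h \<in> eigenspace_sum (Suc n) 2 i (Suc j)"
proof -
  have "tensor_fst (\<lambda>_. 1) h \<in> eigenspace_sum (Suc n) 2 i (Suc j)"
    "tensor_fst sign_char h \<in> eigenspace_sum (Suc n) 2 i (Suc j)"
    by (auto intro: eigenspace_sum_mono[THEN subsetD, OF _ _ tensor_const_eigenspace_sum[OF assms]]
        eigenspace_sum_mono[THEN subsetD, OF _ _ tensor_sign_eigenspace_sum[OF assms]])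
  from eigenspace_sum_lincomb[OF this, of "1/2" "1/2"]
  show ?thesis
    by (rule back_subst[of "\<lambda>f. f \<in> _"])
      (auto simp: fun_eq_iff tensor_fst_def less_2_cases_iff split: list.split)
qed

text \<open>The tensor product with \<open>\<delta>\<^bsub>01\<^esub> - \<delta>\<^bsub>10\<^esub>\<close>. With the constant function \<open>c\<close> and the
  sign character \<open>s\<close> this factor is \<open>(s \<otimes> c - c \<otimes> s) / 2\<close>: the terms \<open>c \<otimes> c\<close> and \<open>s \<otimes> s\<close>,
  which have other eigenvalues, cancel.\<close>

definition tensor_antisym :: "(nat list \<Rightarrow> real) \<Rightarrow> nat list \<Rightarrow> real" where
  "tensor_antisym h z =
     (tensor_fst sign_char (tensor_fst (\<lambda>_. 1) h) z
       - tensor_fst (\<lambda>_. 1) (tensor_fst sign_char h) z) / 2"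

lemma tensor_antisym_eigenspace_sum:
  assumes "h \<in> eigenspace_sum n 2 i j"
  shows "tensor_antisym h \<in> eigenspace_sum (Suc (Suc n)) 2 (Suc i) (Suc j)"
proof -
  from eigenspace_sum_lincomb
    [OF tensor_sign_eigenspace_sum[OF tensor_const_eigenspace_sum[OF assms]]
        tensor_const_eigenspace_sum[OF tensor_sign_eigenspace_sum[OF assms]], of "1/2" "-1/2"]
  show ?thesis
    by (rule back_subst[of "\<lambda>f. f \<in> _"]) (auto simp: fun_eq_iff tensor_antisym_def)
qed

lemma support_size_tensor_sign:
  "support_size (Suc n) 2 (tensor_fst sign_char h) = 2 * support_size n 2 h"
  by (simp add: support_size_Suc) (simp add: support_size_def)

lemma support_size_tensor_point:
  "support_size (Suc n) 2 (tensor_fst (\<lambda>a. of_bool (a = 0)) h) = support_size n 2 h"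
  by (simp add: support_size_Suc) (simp add: support_size_def)

lemma support_size_tensor_antisym:
  "support_size (Suc (Suc n)) 2 (tensor_antisym h) = 2 * support_size n 2 h"
  by (simp add: support_size_Suc tensor_antisym_def) (simp add: support_size_def)

text \<open>Each step peels off one tensor factor: a point mass as long as \<open>i < j\<close>, then a sign
  character as long as \<open>2 i > n\<close>, and an antisymmetric pair in the remaining case \<open>2 i = n\<close>.
  The case of equality \<open>i + j = n\<close> has to be included, since peeling leads to it.\<close>

lemma support_size_attained:
  assumes "i \<le> j" "j \<le> n" "n \<le> i + j"
  shows "\<exists>f \<in> eigenspace_sum n 2 i j. support_size n 2 f = 2 ^ i"
  using assms
proof (induction n arbitrary: i j rule: less_induct)
  case (less n)
  consider "n = 0" | "i < j" | "i = j" "n < 2 * i" | "i = j" "n = 2 * i" "n > 0"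
    using less.prems by linarith
  then show ?case
  proof cases
    case 1
    let ?f = "\<lambda>x :: nat list. of_bool (x = []) :: real"
    have "?f \<in> eigenspace 0 2 0"
      by (simp add: eigenspace_def vertex_functions_def hamming_vertices_0 hamming_nbrs_def
          hamming_adj_def hamming_eigenvalue_def)
    then have "?f \<in> eigenspace_sum 0 2 0 0"
      unfolding eigenspace_sum_def by (intro CollectI exI[of _ "\<lambda>_. ?f"]) auto
    moreover have "{x. x = [] \<and> ?f x \<noteq> 0} = {[]}"
      by auto
    then have "support_size 0 2 ?f = 1"
      by (simp add: support_size_def hamming_vertices_0)
    moreover have "i = 0" "j = 0"
      using 1 less.prems by simp_all
    ultimately show ?thesis using 1 by auto
  next
    case 2
    then obtain m l where [simp]: "n = Suc m" "j = Suc l"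
      using less.prems by (cases n; cases j) auto
    obtain h where "h \<in> eigenspace_sum m 2 i l" "support_size m 2 h = 2 ^ i"
      using less.IH[of m i l] less.prems 2 by auto
    then show ?thesis
      by (intro bexI[of _ "tensor_fst (\<lambda>a. of_bool (a = 0)) h"])
        (simp_all add: support_size_tensor_point tensor_point_eigenspace_sum)
  next
    case 3
    then obtain m l where [simp]: "n = Suc m" "i = Suc l" "j = Suc l"
      using less.prems by (cases n; cases i) auto
    obtain h where "h \<in> eigenspace_sum m 2 l l" "support_size m 2 h = 2 ^ l"
      using less.IH[of m l l] less.prems 3 by auto
    then show ?thesis
      by (intro bexI[of _ "tensor_fst sign_char h"])
        (simp_all add: support_size_tensor_sign tensor_sign_eigenspace_sum)
  next
    case 4
    then obtain l where [simp]: "i = Suc l" "j = Suc l"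
      by (cases i) auto
    have [simp]: "n = Suc (Suc (2 * l))"
      using 4 by simp
    obtain h where "h \<in> eigenspace_sum (2 * l) 2 l l" "support_size (2 * l) 2 h = 2 ^ l"
      using less.IH[of "2 * l" l l] by auto
    then show ?thesis
      by (intro bexI[of _ "tensor_antisym h"])
        (simp_all add: support_size_tensor_antisym tensor_antisym_eigenspace_sum)
  qed
qed

theorem theorem4:
  fixes n i j :: nat
  assumes "n \<ge> 1" and "i \<le> j" and "j \<le> n" and "i + j > n"
  shows "(\<forall>f \<in> eigenspace_sum n 2 i j. f \<noteq> (\<lambda>x. 0) \<longrightarrow> support_size n 2 f \<ge> 2 ^ i) \<and>
         (\<exists>f \<in> eigenspace_sum n 2 i j. f \<noteq> (\<lambda>x. 0) \<and> support_size n 2 f = 2 ^ i)"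
proof -
  obtain f where f: "f \<in> eigenspace_sum n 2 i j" "support_size n 2 f = 2 ^ i"
    using support_size_attained[of i j n] assms by auto
  moreover have "f \<noteq> (\<lambda>x. 0)"
    using f(2) by (auto simp: support_size_def)
  ultimately show ?thesis
    using support_size_ge by blast
qed

end
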